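(* If $-1<a\le0$ and $d\ge0$ are real, then for every integer $n\ge0$ and every $x\in[-1,1]$, $$\left|\mathcal B_{n,d}^{(a)}(x)\right|\le1.$$ The constant is sharp: when $d=0$, equality holds at $x=-1$.
   Context: For $a>-1$, $d\ge0$, $n\in\mathbb N_0$, $$\mathcal B_{n,d}^{(a)}(x)=\left[\frac{\Gamma(n+1)\Gamma(n+a+d+1)}{\Gamma(n+a+1)\Gamma(n+d+1)}\right]^{1/2}\left(\frac{1+x}2\right)^{d/2}P_n^{(a,d)}(x),$$ where $P_n^{(a,d)}$ is the Jacobi polynomial in the standard normalization, $P_n^{(a,d)}(1)=\frac{\Gamma(n+a+1)}{n!\,\Gamma(a+1)}$. When $d=0$ the factor $((1+x)/2)^{d/2}$ is $1$, also at $x=-1$. *)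

theory Defs
  imports "HOL-Analysis.Analysis"
begin

text \<open>The two-binomial expansion of the Jacobi polynomial obtained from Rodrigues' formula by
  Leibniz' rule (Szego, Orthogonal Polynomials, (4.3.2)). Lemma \<open>jacobi_P_at_1\<close> below confirms
  that this is the standard normalization.\<close>

definition jacobi_P :: "nat \<Rightarrow> real \<Rightarrow> real \<Rightarrow> real \<Rightarrow> real" where
  "jacobi_P n a b x =
     (\<Sum>s\<le>n. ((real n + a) gchoose (n - s)) * ((real n + b) gchoose s)
            * ((x - 1) / 2) ^ s * ((x + 1) / 2) ^ (n - s))"

lemma jacobi_P_at_1:
  assumes "a > -1"
  shows "jacobi_P n a b 1 = Gamma (real n + a + 1) / (fact n * Gamma (a + 1))"
proof -
  have "jacobi_P n a b 1 = (\<Sum>s\<le>n. if s = 0 then (real n + a) gchoose n else 0)"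
    unfolding jacobi_P_def by (rule sum.cong) auto
  also have "\<dots> = (real n + a) gchoose n"
    by simp
  also have "\<dots> = Gamma (real n + a + 1) / (fact n * Gamma (a + 1))"
    using assms by (subst gbinomial_Gamma) (auto elim!: nonpos_Ints_cases')
  finally show ?thesis .
qed

text \<open>The case distinction is needed because \<open>0 powr 0 = 0\<close>, whereas for \<open>d = 0\<close> the weight
  is to be \<open>1\<close> also at \<open>x = -1\<close>.\<close>

definition jacobi_B :: "nat \<Rightarrow> real \<Rightarrow> real \<Rightarrow> real \<Rightarrow> real" where
  "jacobi_B n d a x =
     sqrt (Gamma (real n + 1) * Gamma (real n + a + d + 1)
           / (Gamma (real n + a + 1) * Gamma (real n + d + 1)))
     * (if d = 0 then 1 else ((1 + x) / 2) powr (d / 2))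
     * jacobi_P n a d x"

end

theory Submission
  imports Defs
begin

text \<open>
  Put \<open>t = (1 + x) / 2\<close>. For \<open>a = 0\<close> and integral \<open>d\<close> the function \<open>\<B> n d\<close> is a diagonal Wigner matrix
  element, hence bounded by one. For real \<open>d\<close> the Clebsch-Gordan decomposition survives in the
  following form: the square of \<open>\<B> n d\<close> is a convex combination of the functions \<open>\<B> k (2 d)\<close> with
  \<open>k \<le> 2 n\<close>. Repeated squaring reduces dyadic rational \<open>d\<close> to integral \<open>d\<close>, and continuity in \<open>d\<close>
  gives all real \<open>d \<ge> 0\<close>.

  For \<open>-1 < a < 0\<close> the Jacobi polynomial with parameters \<open>(a, d)\<close> at \<open>t\<close> is the average of the one with
  parameters \<open>(0, d)\<close> at \<open>t s\<close>, where \<open>s\<close> has the beta distribution with parameters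
  \<open>(n + a + d + 1, - a)\<close>. Inserting the bound for \<open>a = 0\<close> leaves a quotient of beta functions, which is
  controlled by the normalising factor because \<open>Beta\<close> is log-convex in its first argument.
\<close>

subsection \<open>Krawtchouk-type polynomials\<close>

text \<open>\<open>krawt n d k\<close> is the coefficient of \<open>z ^ k\<close> in \<open>(1 - z) powr (n + d) * (1 + r z) ^ n\<close>, as a
  polynomial in \<open>r\<close>.\<close>

definition krawt :: "nat \<Rightarrow> real \<Rightarrow> nat \<Rightarrow> real poly" where
  "krawt n d k =
     (\<Sum>j\<le>n. monom (if j \<le> k then real (n choose j) * ((real n + d) gchoose (k - j)) * (-1) ^ (k - j) else 0) j)"

lemma coeff_krawt:
  "coeff (krawt n d k) j =
     (if j \<le> k then real (n choose j) * ((real n + d) gchoose (k - j)) * (-1) ^ (k - j) else 0)"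
  by (simp add: krawt_def coeff_sum binomial_eq_0)

lemma krawt_0: "krawt n d 0 = 1"
  by (rule poly_eqI) (simp add: coeff_krawt)

lemma degree_krawt_le: "degree (krawt n d k) \<le> min n k"
  by (rule degree_le) (auto simp: coeff_krawt binomial_eq_0)

lemma gbinomial_step:
  "(M gchoose Suc m) * (real m + 1) = (M - real m) * (M gchoose m)" for M :: real
  using gbinomial_absorb_comp[of M m] gbinomial_absorption[of m M]
  by (simp add: algebra_simps gbinomial_mult_1)

lemma binomial_step: "real (n choose Suc j) * (real j + 1) = (real n - real j) * real (n choose j)"
  using gbinomial_step[of "real n" j] by (simp add: binomial_gbinomial)

text \<open>With G = (1 - z)^(n + d) (1 + r z)^n, this is the coefficient of z^(k + 1) in (1 + r)
  dG/dr = z (1 - z) dG/dz + (2 n + d) z G.\<close>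

lemma pderiv_krawt_Suc:
  "[:1, 1:] * pderiv (krawt n d (Suc k)) =
     smult (real (Suc k)) (krawt n d (Suc k)) + smult (2 * real n + d - real k) (krawt n d k)"
proof (rule poly_eqI)
  fix j
  let ?M = "real n + d"
  have 1: "coeff ([:1, 1:] * pderiv p) j = (real j + 1) * coeff p (Suc j) + real j * coeff p j" for p :: "real poly"
    by (cases j) (simp_all add: coeff_pderiv coeff_pCons algebra_simps)
  show "coeff ([:1, 1:] * pderiv (krawt n d (Suc k))) j = coeff (smult (real (Suc k)) (krawt n d (Suc k)) + smult (2 * real n + d - real k) (krawt n d k)) j"
  proof (cases "j \<le> k")
    case True
    define m where "m = k - j"
    have k: "k = j + m" "Suc k - j = Suc m" using True by (auto simp: m_def)
    define e b b' c c' where defs: "e = (-1 :: real) ^ m" "b = (?M gchoose m)" "b' = (?M gchoose Suc m)"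
      "c = real (n choose j)" "c' = real (n choose Suc j)"
    have "c' * (real j + 1) = (real n - real j) * c" "b' * (real m + 1) = (?M - real m) * b"
      unfolding defs by (rule binomial_step gbinomial_step)+
    then show ?thesis unfolding 1 coeff_add coeff_smult coeff_krawt
      apply (simp add: k flip: defs)
      by algebra
  next
    case False
    then show ?thesis unfolding 1 by (cases "j = Suc k") (auto simp: coeff_krawt)
  qed
qed

text \<open>The coefficient of z^k in r (1 + r) dG/dr = (n r - n - d) G - (1 - z) dG/dz, for the
  same generating function G.\<close>

lemma pderiv_krawt_raise:
  "[:0, 1, 1:] * pderiv (krawt n d k) =
     [:real k - real n - d, real n:] * krawt n d k - smult (real (Suc k)) (krawt n d (Suc k))"
proof (rule poly_eqI)
  fix j
  let ?M = "real n + d"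
  show "coeff ([:0, 1, 1:] * pderiv (krawt n d k)) j =
     coeff ([:real k - real n - d, real n:] * krawt n d k - smult (real (Suc k)) (krawt n d (Suc k))) j"
  proof (cases j)
    case 0
    define e b b' where defs: "e = (-1 :: real) ^ k" "b = (?M gchoose k)" "b' = (?M gchoose Suc k)"
    have "b' * (real k + 1) = (?M - real k) * b"
      unfolding defs by (rule gbinomial_step)
    then show ?thesis unfolding 0
      apply (simp add: coeff_krawt flip: defs)
      by algebra
  next
    case (Suc i)
    have coeff_lhs: "coeff ([:0, 1, 1:] * pderiv p) j = real j * coeff p j + real i * coeff p i" for p :: "real poly"
      by (cases i) (simp_all add: coeff_pderiv coeff_pCons Suc algebra_simps)
    consider "j \<le> k" | "j = Suc k" | "j > Suc k" by linarith
    then show ?thesis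
    proof cases
      case 1
      define m where "m = k - j"
      have k: "k = Suc (i + m)" "k - j = m" "Suc k - j = Suc m" "k - i = Suc m" using 1 Suc by (auto simp: m_def)
      define e b b' c c' where defs: "e = (-1 :: real) ^ m" "b = (?M gchoose m)" "b' = (?M gchoose Suc m)"
        "c = real (n choose i)" "c' = real (n choose Suc i)"
      have "c' * (real i + 1) = (real n - real i) * c" "b' * (real m + 1) = (?M - real m) * b"
        unfolding defs by (rule binomial_step gbinomial_step)+
      then show ?thesis unfolding coeff_lhs unfolding Suc
        apply (simp add: coeff_krawt k(1) flip: defs)
        by algebra
    next
      case 2
      then show ?thesis unfolding coeff_lhs
        using binomial_step[of n i] Suc
        by (simp add: coeff_krawt algebra_simps)
    next
      case 3
      then show ?thesis unfolding coeff_lhs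
        using Suc by (simp add: coeff_krawt)
    qed
  qed
qed

text \<open>Truncated subtraction gives \<open>0 - 1 = 0\<close>, so the vanishing coefficient of
  z^(-1) is put in by hand.\<close>

definition krawt_pred :: "nat \<Rightarrow> real \<Rightarrow> nat \<Rightarrow> real poly" where
  "krawt_pred n d k = (if k = 0 then 0 else krawt n d (k - 1))"

lemma pderiv_krawt_lower:
  "[:1, 1:] * pderiv (krawt n d k) =
     smult (real k) (krawt n d k) + smult (2 * real n + d - real k + 1) (krawt_pred n d k)"
  using pderiv_krawt_Suc[of n d "k - 1"]
  by (cases k) (simp_all add: krawt_pred_def krawt_0 pderiv_1 add_diff_eq del: mult_pCons_left)

text \<open>On degree-\<open>L\<close> polynomials these are the ladder operators of \<open>sl\<^sub>2\<close>; their composition \<open>casimir\<close> acts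
  on \<open>(1 + r) ^ L\<close> times a function of \<open>t = r / (1 + r)\<close> as the Jacobi differential operator
  with parameters \<open>(0, D)\<close>.\<close>

definition lower_op :: "nat \<Rightarrow> real poly \<Rightarrow> real poly" where
  "lower_op L p = [:1, 1:] * pderiv p - smult (real L) p"

definition raise_op :: "nat \<Rightarrow> real \<Rightarrow> real poly \<Rightarrow> real poly" where
  "raise_op L D p = [:- D - 1, real L:] * p - [:0, 1, 1:] * pderiv p"

definition casimir :: "nat \<Rightarrow> real \<Rightarrow> real poly \<Rightarrow> real poly" where
  "casimir L D p = raise_op L D (lower_op L p)"

lemma lower_op_add: "lower_op L (p + q) = lower_op L p + lower_op L q"
  by (simp add: lower_op_def pderiv_add smult_add_right algebra_simps)
lemma lower_op_smult: "lower_op L (smult c p) = smult c (lower_op L p)"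
  by (simp add: lower_op_def pderiv_smult smult_diff_right smult_add_right mult.commute)
lemma raise_op_add: "raise_op L D (p + q) = raise_op L D p + raise_op L D q"
  by (simp add: raise_op_def pderiv_add smult_add_right algebra_simps)
lemma raise_op_smult: "raise_op L D (smult c p) = smult c (raise_op L D p)"
  by (simp add: raise_op_def pderiv_smult smult_diff_right smult_add_right mult.commute)

lemma casimir_add: "casimir L D (p + q) = casimir L D p + casimir L D q"
  by (simp add: casimir_def lower_op_add raise_op_add)
lemma casimir_smult: "casimir L D (smult c p) = smult c (casimir L D p)"
  by (simp add: casimir_def lower_op_smult raise_op_smult)
lemma casimir_0: "casimir L D 0 = 0"
  by (simp add: casimir_def lower_op_def raise_op_def)
lemma casimir_sum: "casimir L D (sum f A) = (\<Sum>a\<in>A. casimir L D (f a))"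
  by (induction A rule: infinite_finite_induct) (simp_all add: casimir_add casimir_0)

text \<open>Product rule: each factor contributes its own index times the product, and these
  diagonal terms add up to \<open>L\<close> and cancel.\<close>

lemma lower_op_krawt_mult:
  assumes "i + j = L"
  shows "lower_op L (krawt n d i * krawt n d j) =
    smult (2 * real n + d - real i + 1) (krawt_pred n d i * krawt n d j)
    + smult (2 * real n + d - real j + 1) (krawt n d i * krawt_pred n d j)"
proof -
  have "lower_op L (krawt n d i * krawt n d j) =
     ([:1, 1:] * pderiv (krawt n d i)) * krawt n d j + krawt n d i * ([:1, 1:] * pderiv (krawt n d j))
     - smult (real L) (krawt n d i * krawt n d j)"
    by (simp add: lower_op_def pderiv_mult algebra_simps)
  also have "\<dots> = smult (2 * real n + d - real i + 1) (krawt_pred n d i * krawt n d j)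
    + smult (2 * real n + d - real j + 1) (krawt n d i * krawt_pred n d j)"
    unfolding pderiv_krawt_lower by (rule poly_eq_poly_eq_iff[THEN iffD1], rule ext)
      (simp add: algebra_simps flip: assms)
  finally show ?thesis .
qed

text \<open>The product rule gives the constants \<open>real i - real n - d\<close> and
  \<open>real j - real n - d\<close>, whose sum is -2 d - 1 because i + j = 2 n - 1. Hence the
  parameter \<open>2 * d\<close>.\<close>

lemma raise_op_krawt_mult:
  assumes "Suc (i + j) = 2 * n"
  shows "raise_op (2 * n) (2 * d) (krawt n d i * krawt n d j) =
    smult (real (Suc i)) (krawt n d (Suc i) * krawt n d j)
    + smult (real (Suc j)) (krawt n d i * krawt n d (Suc j))"
proof -
  have r: "2 * real n = real i + real j + 1" using assms by linarith
  have "raise_op (2 * n) (2 * d) (krawt n d i * krawt n d j) =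
     [:- 2 * d - 1, 2 * real n:] * (krawt n d i * krawt n d j)
     - ([:0, 1, 1:] * pderiv (krawt n d i)) * krawt n d j - krawt n d i * ([:0, 1, 1:] * pderiv (krawt n d j))"
    by (simp add: raise_op_def pderiv_mult algebra_simps)
  also have "\<dots> = smult (real (Suc i)) (krawt n d (Suc i) * krawt n d j)
    + smult (real (Suc j)) (krawt n d i * krawt n d (Suc j))" (is "?A = ?B")
    unfolding pderiv_krawt_raise
  proof (rule poly_eq_poly_eq_iff[THEN iffD1], rule ext)
    fix x
    define a a' b b' where defs: "a = poly (krawt n d i) x" "a' = poly (krawt n d (Suc i)) x"
      "b = poly (krawt n d j) x" "b' = poly (krawt n d (Suc j)) x"
    show "poly ([:- 2 * d - 1, 2 * real n:] * (krawt n d i * krawt n d j) -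
          ([:real i - real n - d, real n:] * krawt n d i - smult (real (Suc i)) (krawt n d (Suc i))) *
          krawt n d j -
          krawt n d i *
          ([:real j - real n - d, real n:] * krawt n d j -
           smult (real (Suc j)) (krawt n d (Suc j)))) x = poly ?B x"
      using r
      apply (simp flip: defs)
      by algebra
  qed
  finally show ?thesis .
qed

text \<open>Lowering one factor and then raising one moves (i, j) at most one step along i + j = 2
  n, so the Casimir operator is tridiagonal on these products.\<close>

lemma casimir_krawt_mult:
  fixes d :: real
  assumes "i \<le> 2 * n"
  defines "N \<equiv> 2 * real n + d" and "j \<equiv> 2 * n - i"
  shows "casimir (2 * n) (2 * d) (krawt n d i * krawt n d j) =
    smult ((N - real i + 1) * real i + (N - real j + 1) * real j) (krawt n d i * krawt n d j)
    + (if i = 0 then 0 else smult ((N - real i + 1) * (real j + 1)) (krawt n d (i - 1) * krawt n d (j + 1)))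
    + (if j = 0 then 0 else smult ((N - real j + 1) * (real i + 1)) (krawt n d (i + 1) * krawt n d (j - 1)))"
proof -
  have ij: "i + j = 2 * n" using assms by simp
  have 1: "raise_op (2 * n) (2 * d) (krawt_pred n d i * krawt n d j) =
    (if i = 0 then 0 else smult (real i) (krawt n d i * krawt n d j) + smult (real j + 1) (krawt n d (i - 1) * krawt n d (j + 1)))"
  proof (cases i)
    case 0 then show ?thesis by (simp add: krawt_pred_def raise_op_def)
  next
    case (Suc i')
    with raise_op_krawt_mult[of i' j n d] ij show ?thesis by (simp add: krawt_pred_def add.commute)
  qed
  have 2: "raise_op (2 * n) (2 * d) (krawt n d i * krawt_pred n d j) =
    (if j = 0 then 0 else smult (real i + 1) (krawt n d (i + 1) * krawt n d (j - 1)) + smult (real j) (krawt n d i * krawt n d j))"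
  proof (cases j)
    case 0 then show ?thesis by (simp add: krawt_pred_def raise_op_def)
  next
    case (Suc j')
    with raise_op_krawt_mult[of i j' n d] ij show ?thesis by (simp add: krawt_pred_def add.commute)
  qed
  show ?thesis
    unfolding casimir_def lower_op_krawt_mult[OF ij] raise_op_add raise_op_smult 1 2 N_def
    by (simp add: smult_add_right smult_smult flip: smult_add_left)
qed

section \<open>Eigenvectors of the Casimir operator\<close>

text \<open>The power of 1 + r pads to degree \<open>L\<close>: at r = t / (1 - t), the value times
  (1 - t)^L is independent of \<open>L\<close> for L \<ge> k.\<close>

definition wigner_poly :: "nat \<Rightarrow> real \<Rightarrow> nat \<Rightarrow> real poly" where
  "wigner_poly L D k = [:1, 1:] ^ (L - k) * krawt k D k"

text \<open>Lowering leads to \<open>krawt_pred k D k\<close> with factor k + D + 1, and raising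
  returns with factor k. The eigenvalue is that of the Jacobi equation with parameters (0,
  D).\<close>

lemma casimir_krawt_diag:
  "casimir k D (krawt k D k) = smult (real k * (real k + D + 1)) (krawt k D k)"
proof -
  have l: "lower_op k (krawt k D k) = smult (real k + D + 1) (krawt_pred k D k)"
    by (simp add: lower_op_def pderiv_krawt_lower del: mult_pCons_left)
  show ?thesis
  proof (cases k)
    case 0
    then have "lower_op k (krawt k D k) = 0" unfolding l by (simp add: krawt_pred_def)
    with 0 show ?thesis by (simp add: casimir_def raise_op_def)
  next
    case (Suc m)
    have "raise_op k D (krawt k D m) = smult (real k) (krawt k D k)"
      unfolding raise_op_def pderiv_krawt_raise
      by (rule poly_eq_poly_eq_iff[THEN iffD1], rule ext) (simp add: Suc algebra_simps)
    then show ?thesis unfolding casimir_def l raise_op_smult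
      by (simp add: krawt_pred_def Suc mult.commute)
  qed
qed

text \<open>Differentiating the factor 1 + r produces just the term that compensates the increase of
  \<open>L\<close> by one, in both ladder operators.\<close>

lemma casimir_shift:
  "casimir (Suc L) D ([:1, 1:] * p) = [:1, 1:] * casimir L D p"
proof -
  have l: "lower_op (Suc L) ([:1, 1:] * p) = [:1, 1:] * lower_op L p" for p
    unfolding lower_op_def pderiv_mult
    by (rule poly_eq_poly_eq_iff[THEN iffD1], rule ext) (simp add: pderiv_pCons algebra_simps)
  have r: "raise_op (Suc L) D ([:1, 1:] * p) = [:1, 1:] * raise_op L D p" for p
    unfolding raise_op_def pderiv_mult
    by (rule poly_eq_poly_eq_iff[THEN iffD1], rule ext) (simp add: pderiv_pCons algebra_simps)
  show ?thesis unfolding casimir_def l r ..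
qed

lemma wigner_poly_Suc: "k \<le> L \<Longrightarrow> wigner_poly (Suc L) D k = [:1, 1:] * wigner_poly L D k"
  by (simp add: wigner_poly_def Suc_diff_le mult.assoc del: mult_pCons_left)

lemma casimir_wigner_poly:
  assumes "k \<le> L"
  shows "casimir L D (wigner_poly L D k) = smult (real k * (real k + D + 1)) (wigner_poly L D k)"
  using assms
proof (induction L rule: dec_induct)
  case base
  show ?case by (simp add: wigner_poly_def casimir_krawt_diag)
next
  case (step L)
  then show ?case by (simp add: wigner_poly_Suc casimir_shift del: mult_pCons_left)
qed

subsection \<open>Squares as convex combinations\<close>

lemma gbinomial_pos:
  fixes x :: real
  assumes "real k \<le> x"
  shows "x gchoose k > 0"
  unfolding gbinomial_prod_rev
proof (rule divide_pos_pos)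
  show "(\<Prod>i = 0..<k. x - real i) > 0"
    by (rule prod_pos) (use assms in auto)
qed simp

text \<open>At r = -1 all terms have sign (-1)^L, and Vandermonde sums them to a positive binomial.
  Since 1 + r divides \<open>wigner_poly L D k\<close> for k < L but not for k = L, the family is
  triangular.\<close>

lemma poly_krawt_diag_nonzero:
  assumes "D \<ge> 0"
  shows "poly (krawt L D L) (-1) \<noteq> 0"
proof -
  have "poly (krawt L D L) (-1) = (\<Sum>j\<le>L. (-1) ^ L * ((real L gchoose j) * ((real L + D) gchoose (L - j))))"
    unfolding krawt_def poly_sum
  proof (rule sum.cong[OF refl])
    fix j assume "j \<in> {..L}"
    then have "(-1 :: real) ^ L = (-1) ^ (L - j) * (-1) ^ j"
      by (simp flip: power_add)
    then show "poly (monom (if j \<le> L then real (L choose j) * ((real L + D) gchoose (L - j)) * (-1) ^ (L - j) else 0) j) (-1)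
        = (-1) ^ L * ((real L gchoose j) * ((real L + D) gchoose (L - j)))"
      using \<open>j \<in> _\<close> by (simp add: poly_monom binomial_gbinomial)
  qed
  also have "\<dots> = (-1) ^ L * ((real L + (real L + D)) gchoose L)"
    by (simp only: gbinomial_Vandermonde atMost_atLeast0 flip: sum_distrib_left)
  finally show ?thesis
    using gbinomial_pos[of L "real L + (real L + D)"] assms by simp
qed

lemma coeff_mult_top:
  fixes p q :: "'a::comm_semiring_0 poly"
  assumes "degree p \<le> a" "degree q \<le> b"
  shows "coeff (p * q) (a + b) = coeff p a * coeff q b"
proof -
  have "coeff (p * q) (a + b) = (\<Sum>i\<le>a + b. if i = a then coeff p a * coeff q b else 0)"
    unfolding coeff_mult
  proof (rule sum.cong[OF refl])
    fix i
    consider "i < a" | "i = a" | "i > a" by linarith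
    then show "coeff p i * coeff q (a + b - i) = (if i = a then coeff p a * coeff q b else 0)"
      by cases (use assms in \<open>auto simp: coeff_eq_0\<close>)
  qed
  then show ?thesis by simp
qed

text \<open>The coefficient of r^L plays the role of the value at t = 1; comparing it shows that the
  expansion coefficients of the square add up to one.\<close>

lemma coeff_wigner_poly_top:
  assumes "k \<le> L"
  shows "coeff (wigner_poly L D k) L = 1"
proof -
  have deg: "degree ([:1, 1 :: real:] ^ m) = m" for m
    by (simp add: degree_power_eq)
  have "coeff ([:1, 1:] ^ (L - k) * krawt k D k) (L - k + k) = coeff ([:1, 1 :: real:] ^ (L - k)) (L - k) * coeff (krawt k D k) k"
    by (rule coeff_mult_top) (use degree_krawt_le[of k D k] in \<open>auto simp: deg\<close>)
  also have "coeff ([:1, 1 :: real:] ^ (L - k)) (L - k) = 1"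
    using lead_coeff_power[of "[:1, 1 :: real:]" "L - k"] by (simp add: deg)
  finally show ?thesis using assms by (simp add: wigner_poly_def coeff_krawt)
qed

lemma wigner_poly_self: "wigner_poly L D L = krawt L D L"
  by (simp add: wigner_poly_def)

lemma sum_wigner_poly_Suc:
  "(\<Sum>k\<le>Suc L. smult (C k) (wigner_poly (Suc L) D k)) =
     [:1, 1:] * (\<Sum>k\<le>L. smult (C k) (wigner_poly L D k)) + smult (C (Suc L)) (krawt (Suc L) D (Suc L))"
  by (simp add: wigner_poly_Suc wigner_poly_self sum_distrib_left del: mult_pCons_left)

text \<open>Subtract the multiple of \<open>krawt L D L\<close> that makes the polynomial vanish at
  -1, then divide by 1 + r and descend in degree.\<close>

lemma wigner_poly_span:
  assumes "D \<ge> 0" "degree p \<le> L"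
  shows "\<exists>C. p = (\<Sum>k\<le>L. smult (C k) (wigner_poly L D k))"
  using assms(2)
proof (induction L arbitrary: p)
  case 0
  then obtain c where "p = [:c:]" by (auto elim: degree_eq_zeroE)
  then show ?case by (intro exI[of _ "\<lambda>_. c"]) (simp add: wigner_poly_self krawt_0)
next
  case (Suc L)
  define k where "k = krawt (Suc L) D (Suc L)"
  define c where "c = poly p (-1) / poly k (-1)"
  have "poly (p - smult c k) (-1) = 0"
    using poly_krawt_diag_nonzero[OF assms(1), of "Suc L"] by (simp add: c_def k_def)
  then obtain q where q: "p - smult c k = [:1, 1:] * q"
    unfolding poly_eq_0_iff_dvd by (auto elim: dvdE)
  have "degree q \<le> L"
  proof (cases "q = 0")
    case False
    have "degree ([:1, 1:] * q) = Suc (degree q)"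
      using False by (subst degree_mult_eq) auto
    moreover have "degree (p - smult c k) \<le> Suc L"
      using Suc.prems degree_krawt_le[of "Suc L" D "Suc L"]
      by (intro degree_diff_le order_trans[OF degree_smult_le]) (simp_all add: k_def)
    ultimately show ?thesis using q by simp
  qed simp
  then obtain C where C: "q = (\<Sum>k\<le>L. smult (C k) (wigner_poly L D k))" using Suc.IH by blast
  have "p = [:1, 1:] * q + smult c k" using q by (metis diff_add_cancel)
  also have "\<dots> = (\<Sum>k\<le>Suc L. smult ((C(Suc L := c)) k) (wigner_poly (Suc L) D k))"
    unfolding sum_wigner_poly_Suc C k_def by (auto simp del: mult_pCons_left intro!: sum.cong)
  finally show ?case by blast
qed

text \<open>Evaluation at -1 isolates the top coefficient; the rest is divisible by 1 + r.\<close>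

lemma wigner_poly_independent:
  assumes "D \<ge> 0" "(\<Sum>k\<le>L. smult (C k) (wigner_poly L D k)) = 0" "k \<le> L"
  shows "C k = 0"
  using assms(2,3)
proof (induction L)
  case 0
  then show ?case by (simp add: wigner_poly_self krawt_0)
next
  case (Suc L)
  have "poly (\<Sum>k\<le>Suc L. smult (C k) (wigner_poly (Suc L) D k)) (-1) = 0" using Suc.prems by simp
  then have 0: "C (Suc L) = 0"
    unfolding sum_wigner_poly_Suc using poly_krawt_diag_nonzero[OF assms(1), of "Suc L"] by simp
  with Suc.prems(1) have "[:1, 1:] * (\<Sum>k\<le>L. smult (C k) (wigner_poly L D k)) = 0"
    unfolding sum_wigner_poly_Suc by simp
  then have "(\<Sum>k\<le>L. smult (C k) (wigner_poly L D k)) = 0"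
    by (simp only: mult_eq_0_iff pCons_eq_0_iff) simp
  with 0 Suc show ?case by (cases "k = Suc L") auto
qed

lemma smult_sum_right: "smult c (sum f A) = (\<Sum>a\<in>A. smult c (f a))"
  by (induction A rule: infinite_finite_induct) (simp_all add: smult_add_right)

section \<open>Tridiagonal matrices symmetric for a weighted inner product\<close>

definition tridiag_op :: "nat \<Rightarrow> (nat \<Rightarrow> real) \<Rightarrow> (nat \<Rightarrow> real) \<Rightarrow> (nat \<Rightarrow> real) \<Rightarrow> (nat \<Rightarrow> real) \<Rightarrow> nat \<Rightarrow> real" where
  "tridiag_op L dg lo up b i =
     dg i * b i + (if i = 0 then 0 else lo i * b (i - 1)) + (if i = L then 0 else up i * b (i + 1))"

text \<open>The assumption equates the two weighted entries linking i and i + 1, so the bilinear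
  form is a sum of terms symmetric in \<open>a\<close> and \<open>b\<close>.\<close>

lemma tridiag_op_symmetric:
  assumes "\<And>i. i < L \<Longrightarrow> w i * up i = w (Suc i) * lo (Suc i)"
  shows "(\<Sum>i\<le>L. w i * a i * tridiag_op L dg lo up b i) = (\<Sum>i\<le>L. w i * tridiag_op L dg lo up a i * b i)"
proof -
  have *: "(\<Sum>i\<le>L. w i * a i * tridiag_op L dg lo up b i) =
     (\<Sum>i\<le>L. w i * dg i * a i * b i) + (\<Sum>i<L. w i * up i * (a (Suc i) * b i + a i * b (Suc i)))" for a b
  proof -
    have "(\<Sum>i\<le>L. w i * a i * tridiag_op L dg lo up b i) =
      (\<Sum>i\<le>L. w i * dg i * a i * b i) + (\<Sum>i\<le>L. if i = 0 then 0 else w i * lo i * a i * b (i - 1))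
       + (\<Sum>i\<le>L. if i = L then 0 else w i * up i * a i * b (Suc i))"
      unfolding sum.distrib[symmetric] by (rule sum.cong) (auto simp: tridiag_op_def algebra_simps)
    also have "(\<Sum>i\<le>L. if i = 0 then 0 else w i * lo i * a i * b (i - 1)) = (\<Sum>i<L. w i * up i * (a (Suc i) * b i))"
      by (subst sum.atMost_shift) (auto intro!: sum.cong simp: assms)
    also have "(\<Sum>i\<le>L. if i = L then 0 else w i * up i * a i * b (Suc i)) = (\<Sum>i<L. w i * up i * (a i * b (Suc i)))"
      unfolding lessThan_Suc_atMost[symmetric] sum.lessThan_Suc by (auto intro!: sum.cong)
    finally show ?thesis by (simp add: sum.distrib algebra_simps)
  qed
  have "(\<Sum>i\<le>L. w i * tridiag_op L dg lo up a i * b i) = (\<Sum>i\<le>L. w i * b i * tridiag_op L dg lo up a i)"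
    by (rule sum.cong) (simp_all only: mult_ac)
  also have "\<dots> = (\<Sum>i\<le>L. w i * a i * tridiag_op L dg lo up b i)"
    unfolding * by (intro arg_cong2[of _ _ _ _ "(+)"] sum.cong refl) algebra+
  finally show ?thesis ..
qed

text \<open>The products \<open>krawt n d i * krawt n d (2 * n - i)\<close> are expanded into eigenvectors of \<open>casimir\<close>. For each
  eigenvalue the coefficients, as a vector in \<open>i\<close>, form an eigenvector of a tridiagonal matrix that is
  symmetric for positive weights \<open>w\<close>, so these vectors are orthogonal. At \<open>r = \<infinity>\<close> they sum
  to the \<open>n\<close>-th unit vector, hence their \<open>n\<close>-th entries are squared norms divided by \<open>w n\<close>.\<close>

lemma krawt_square:
  assumes d: "d \<ge> 0"
  shows "\<exists>C. (\<forall>k\<le>2 * n. C k \<ge> 0) \<and> (\<Sum>k\<le>2 * n. C k) = 1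
    \<and> (krawt n d n)\<^sup>2 = (\<Sum>k\<le>2 * n. smult (C k) (wigner_poly (2 * n) (2 * d) k))"
proof -
  define L where "L = 2 * n"
  define N where "N = 2 * real n + d"
  define F where "F i = krawt n d i * krawt n d (L - i)" for i
  define W where "W = wigner_poly L (2 * d)"
  define ev where "ev k = real k * (real k + 2 * d + 1)" for k
  define dg where "dg i = (N - real i + 1) * real i + (N - real (L - i) + 1) * real (L - i)" for i
  define lo where "lo i = (N - real i + 1) * (real (L - i) + 1)" for i
  define up where "up i = (N - real (L - i) + 1) * (real i + 1)" for i
  \<comment> \<open>The step ratios of the binomials make these weights symmetrise \<open>lo\<close>
    and \<open>up\<close>; since N \<ge> 2 n, they are positive for i \<le> L.\<close>
  define w where "w i = 1 / ((N gchoose i) * (N gchoose (L - i)))" for i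
  let ?J = "tridiag_op L dg lo up"
  have "degree (F i) \<le> L" for i
    using degree_mult_le[of "krawt n d i" "krawt n d (L - i)"] degree_krawt_le[of n d i]
      degree_krawt_le[of n d "L - i"] unfolding F_def L_def by linarith
  then have "\<exists>C. F i = (\<Sum>k\<le>L. smult (C k) (W k))" for i
    unfolding W_def by (intro wigner_poly_span) (use d in auto)
  then obtain C where C: "\<And>i. F i = (\<Sum>k\<le>L. smult (C i k) (W k))" by metis
  \<comment> \<open>Linear independence turns the action of \<open>casimir\<close> on
    \<open>F i\<close> into an eigenvector equation for each k.\<close>
  have eigen: "?J (\<lambda>i. C i k) i = ev k * C i k" if "i \<le> L" "k \<le> L" for i k
  proof -
    have "casimir L (2 * d) (F i) =
       smult (dg i) (F i) + (if i = 0 then 0 else smult (lo i) (F (i - 1))) + (if i = L then 0 else smult (up i) (F (i + 1)))"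
      using casimir_krawt_mult[of i n d] that
      by (auto simp: F_def dg_def lo_def up_def L_def N_def Suc_diff_le)
    also have "\<dots> = (\<Sum>k\<le>L. smult (?J (\<lambda>i. C i k) i) (W k))"
      unfolding C tridiag_op_def
      by (auto simp: smult_sum_right smult_add_left sum.distrib)
    finally have 1: "casimir L (2 * d) (F i) = (\<Sum>k\<le>L. smult (?J (\<lambda>i. C i k) i) (W k))" .
    have 2: "casimir L (2 * d) (F i) = (\<Sum>k\<le>L. smult (ev k * C i k) (W k))"
      unfolding C casimir_sum casimir_smult
      by (rule sum.cong) (auto simp: W_def casimir_wigner_poly ev_def mult.commute)
    have "(\<Sum>k\<le>L. smult (?J (\<lambda>i. C i k) i - ev k * C i k) (W k)) = 0"
      using 1 2 by (simp add: smult_diff_left sum_subtractf)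
    then have "?J (\<lambda>i. C i k) i - ev k * C i k = 0"
      unfolding W_def by (rule wigner_poly_independent[rotated]) (use that d in auto)
    then show ?thesis by simp
  qed
  have norm: "(\<Sum>k\<le>L. C i k) = (if i = n then 1 else 0)" if "i \<le> L" for i
  proof -
    have "coeff (W k) L = 1" if "k \<le> L" for k
      unfolding W_def using that by (rule coeff_wigner_poly_top)
    then have "coeff (F i) L = (\<Sum>k\<le>L. C i k)"
      unfolding C by (simp add: coeff_sum)
    moreover have "coeff (F i) L = coeff (krawt n d i) n * coeff (krawt n d (L - i)) n"
      unfolding F_def L_def mult_2
      by (rule coeff_mult_top) (use degree_krawt_le[of n d] in auto)
    \<comment> \<open>For i \<noteq> n one of i and L - i is below n, and that factor has no r^n
      term.\<close>
    then have "coeff (F i) L = (if i = n then 1 else 0)"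
      using that by (auto simp: coeff_krawt L_def)
    ultimately show ?thesis by simp
  qed
  have w_pos: "w i > 0" if "i \<le> L" for i
    unfolding w_def using that d by (auto intro!: divide_pos_pos mult_pos_pos gbinomial_pos simp: N_def L_def)
  have sym: "w i * up i = w (Suc i) * lo (Suc i)" if "i < L" for i
  proof -
    define j where "j = L - Suc i"
    have j: "L - i = Suc j" "L - Suc i = j" using that by (auto simp: j_def)
    have le: "real (Suc i) \<le> N" "real (Suc j) \<le> N" using that d by (auto simp: N_def L_def j_def)
    then have "(N gchoose i) > 0" "(N gchoose Suc i) > 0" "(N gchoose j) > 0" "(N gchoose Suc j) > 0"
      by (auto intro!: gbinomial_pos)
    moreover have "(N gchoose Suc i) * (real i + 1) = (N - real i) * (N gchoose i)"
       "(N gchoose Suc j) * (real j + 1) = (N - real j) * (N gchoose j)"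
      by (rule gbinomial_step)+
    ultimately show ?thesis
      unfolding w_def up_def lo_def j by (simp add: divide_simps) (simp add: mult_ac)
  qed
  have orth: "(\<Sum>i\<le>L. w i * C i k * C i l) = 0" if "k \<le> L" "l \<le> L" "k \<noteq> l" for k l
  proof -
    have "ev l * (\<Sum>i\<le>L. w i * C i k * C i l) = (\<Sum>i\<le>L. w i * C i k * ?J (\<lambda>i. C i l) i)"
      unfolding sum_distrib_left by (rule sum.cong) (use that eigen in auto)
    also have "\<dots> = (\<Sum>i\<le>L. w i * ?J (\<lambda>i. C i k) i * C i l)"
      by (rule tridiag_op_symmetric) (rule sym)
    also have "\<dots> = ev k * (\<Sum>i\<le>L. w i * C i k * C i l)"
      unfolding sum_distrib_left by (rule sum.cong) (use that eigen in auto)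
    finally have "(ev l - ev k) * (\<Sum>i\<le>L. w i * C i k * C i l) = 0" by (simp add: algebra_simps)
    moreover have "ev l - ev k = (real l - real k) * (real l + real k + 2 * d + 1)"
      by (simp add: ev_def algebra_simps)
    then have "ev l - ev k \<noteq> 0" using that d by auto
    ultimately show ?thesis by simp
  qed
  have nL: "n \<le> L" by (simp add: L_def)
  have pos: "C n k \<ge> 0" if k: "k \<le> L" for k
  proof -
    have "w n * C n k = (\<Sum>i\<le>L. w i * C i k * (\<Sum>l\<le>L. C i l))"
    proof -
      have "(\<Sum>i\<le>L. w i * C i k * (\<Sum>l\<le>L. C i l)) = (\<Sum>i\<le>L. if i = n then w n * C n k else 0)"
        by (rule sum.cong) (auto simp: norm)
      then show ?thesis using nL by simp
    qed
    also have "\<dots> = (\<Sum>l\<le>L. \<Sum>i\<le>L. w i * C i k * C i l)"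
      unfolding sum_distrib_left by (rule sum.swap)
    also have "\<dots> = (\<Sum>l\<le>L. if l = k then \<Sum>i\<le>L. w i * C i k * C i k else 0)"
      by (rule sum.cong) (use orth k in auto)
    also have "\<dots> = (\<Sum>i\<le>L. w i * C i k * C i k)" using k by simp
    also have "\<dots> \<ge> 0"
      by (rule sum_nonneg) (simp add: mult.assoc w_pos less_imp_le)
    finally show ?thesis using w_pos[OF nL] by (simp add: zero_le_mult_iff)
  qed
  have "(krawt n d n)\<^sup>2 = (\<Sum>k\<le>L. smult (C n k) (W k))"
    using C[of n] by (simp add: F_def L_def power2_eq_square)
  with pos norm[OF nL] show ?thesis
    by (intro exI[of _ "C n"]) (simp add: L_def W_def)
qed

subsection \<open>Integral parameters\<close>

text \<open>For integral D the generating function is a polynomial in z of degree 2 n + D. This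
  vanishing closes the telescoping sum for the row norm.\<close>

lemma krawt_beyond_degree: "krawt n (real D) (Suc (2 * n + D)) = 0"
proof (rule poly_eqI)
  fix j
  have "(real n + real D) gchoose (Suc (2 * n + D) - j) = 0" if "j \<le> n"
  proof -
    have "(real (n + D)) gchoose (Suc (2 * n + D) - j) = 0"
      unfolding binomial_gbinomial[symmetric] using that by (simp add: binomial_eq_0)
    then show ?thesis by simp
  qed
  then show "coeff (krawt n (real D) (Suc (2 * n + D))) j = coeff 0 j"
    by (cases "j \<le> n") (auto simp: coeff_krawt binomial_eq_0)
qed

lemma pderiv_sum: "pderiv (sum f A) = (\<Sum>a\<in>A. pderiv (f a))"
  by (induction A rule: infinite_finite_induct) (simp_all add: pderiv_add)

text \<open>With k the degree, comparing coefficients of r^(k + 1) forces k = m; a polynomial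
  solution is thus determined by its coefficient at \<open>m\<close>.\<close>

lemma binomial_ode_unique:
  fixes p :: "real poly"
  assumes "[:0, 1, 1:] * pderiv p = [:a, real m:] * p" and "degree p \<le> m" and "coeff p m = 0"
  shows "p = 0"
proof (rule ccontr)
  assume "p \<noteq> 0"
  define k where "k = degree p"
  have k: "k < m" using assms(2,3) \<open>p \<noteq> 0\<close> by (cases "k = m") (auto simp: k_def)
  have "coeff ([:0, 1, 1:] * pderiv p) (Suc k) = real k * coeff p k"
    by (cases k) (simp_all add: coeff_pderiv k_def coeff_eq_0)
  moreover have "coeff ([:a, real m:] * p) (Suc k) = real m * coeff p k"
    by (simp add: coeff_eq_0 k_def)
  ultimately have "real k * coeff p k = real m * coeff p k" using assms(1) by metis
  then show False using k \<open>p \<noteq> 0\<close> by (simp add: k_def)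
qed

text \<open>The raising identity plus x times the lowering identity. Both neighbours appear, and
  with the weights of the row norm their contributions telescope.\<close>

lemma krawt_square_ladder:
  fixes x d :: real and n :: nat
  defines "q k \<equiv> poly (krawt n d k) x"
  shows "2 * (x * (1 + x)) * poly (pderiv (krawt n d k)) x =
    (x * real k + n * x - n - d + real k) * q k
      + x * (2 * n + d - k + 1) * poly (krawt_pred n d k) x - (real k + 1) * q (Suc k)"
proof -
  have 1: "(1 + x) * poly (pderiv (krawt n d k)) x = real k * q k + (2 * n + d - k + 1) * poly (krawt_pred n d k) x"
    using arg_cong[OF pderiv_krawt_lower[of n d k], of "\<lambda>p. poly p x"] by (simp add: q_def algebra_simps)
  have 2: "x * (1 + x) * poly (pderiv (krawt n d k)) x = (real k - n - d + x * n) * q k - (real k + 1) * q (Suc k)"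
    using arg_cong[OF pderiv_krawt_raise[of n d k], of "\<lambda>p. poly p x"] by (simp add: q_def algebra_simps)
  show ?thesis using 1 2 by algebra
qed

text \<open>The rows of the Wigner matrices have norm one.\<close>

lemma krawt_sum_squares:
  fixes n D :: nat
  defines "N \<equiv> 2 * n + D"
  shows "(\<Sum>k\<le>N. smult (1 / real (N choose k)) (monom 1 (N - k) * (krawt n (real D) k)\<^sup>2)) =
    smult (1 / real (N choose n)) (monom 1 n * [:1, 1:] ^ N)" (is "?S = ?R")
proof -
  define q where "q = krawt n (real D)"
  define T where "T k = monom 1 (N - k) * (q k)\<^sup>2" for k
  define w where "w k = 1 / real (N choose k)" for k
  have w_step: "w (Suc k) * (real N - real k) = w k * (real k + 1)" if "k < N" for k
    using binomial_step[of N k] that by (simp add: w_def field_simps)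
  have S: "?S = (\<Sum>k\<le>N. smult (w k) (T k))" by (simp add: T_def w_def q_def)
  \<comment> \<open>Both sides of the claim solve one first-order equation, so only their
    coefficients of r^(N + n) remain to be compared.\<close>
  have odeS: "[:0, 1, 1:] * pderiv ?S = [:real n, real (N + n):] * ?S"
  proof (rule poly_eq_poly_eq_iff[THEN iffD1], rule ext)
    fix x :: real
    \<comment> \<open>\<open>G k\<close> is a flux from k to k + 1: besides its share of the
      right-hand side, the k-th summand leaves the inflow \<open>H k\<close> minus the outflow
      \<open>G k\<close>.\<close>
    define G where "G k = w k * (real k + 1) * x ^ (N - k) * poly (q k) x * poly (q (Suc k)) x" for k
    define H where "H k = (if k = 0 then 0 else G (k - 1))" for k
    have summand: "w k * (x * (1 + x) * poly (pderiv (T k)) x) = (n + (N + n) * x) * (w k * poly (T k) x) + H k - G k"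
      if "k \<le> N" for k
    proof -
      define m where "m = N - k"
      have m: "real N = real k + real m" using that by (simp add: m_def)
      have xm: "x * (real m * x ^ (m - 1)) = real m * x ^ m"
        by (cases m) auto
      define a a' b where ab: "a = poly (q k) x" "a' = poly (pderiv (q k)) x" "b = poly (q (Suc k)) x"
      define c where "c = poly (krawt_pred n (real D) k) x"
      have lad: "2 * (x * (1 + x)) * a' = (x * real k + n * x - n - D + real k) * a
          + x * (real m + 1) * c - (real k + 1) * b"
        using krawt_square_ladder[of x n D k] m unfolding ab c_def q_def N_def by simp
      have H: "H k = w k * (real m + 1) * x ^ Suc m * c * a"
      proof (cases k)
        case (Suc k')
        have "w k' * (real k' + 1) = w k * (real m + 1)" using w_step[of k'] that Suc m by (simp add: add.commute)
        moreover have "N - k' = Suc m" using that Suc by (simp add: m_def)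
        ultimately show ?thesis by (simp add: H_def G_def Suc c_def krawt_pred_def ab q_def)
      qed (simp add: H_def c_def krawt_pred_def)
      have T: "poly (T k) x = x ^ m * a\<^sup>2" by (simp add: T_def m_def poly_monom ab)
      have T': "poly (pderiv (T k)) x = real m * x ^ (m - 1) * a\<^sup>2 + x ^ m * (2 * a * a')"
        by (simp add: T_def m_def[symmetric] pderiv_mult pderiv_monom poly_monom ab power2_eq_square algebra_simps)
      have "x * (1 + x) * poly (pderiv (T k)) x = (1 + x) * (x * (real m * x ^ (m - 1))) * a\<^sup>2 + x ^ m * a * (2 * (x * (1 + x)) * a')"
        unfolding T' by (simp only: algebra_simps)
      also have "\<dots> = (1 + x) * (real m * x ^ m) * a\<^sup>2 + x ^ m * a * ((x * real k + n * x - n - D + real k) * a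
          + x * (real m + 1) * c - (real k + 1) * b)"
        unfolding xm lad ..
      finally have e: "x * (1 + x) * poly (pderiv (T k)) x = \<dots>" .
      have N: "real k + real m = 2 * real n + real D" using m by (simp add: N_def)
      define y where "y = x ^ m"
      have "w k * ((1 + x) * (real m * y) * a\<^sup>2 + y * a * ((x * real k + n * x - n - D + real k) * a
          + x * (real m + 1) * c - (real k + 1) * b)) =
         (n + (real k + real m + n) * x) * (w k * (y * a\<^sup>2)) + w k * (real m + 1) * (x * y) * c * a
         - w k * (real k + 1) * y * a * b"
        using N by algebra
      then show ?thesis unfolding e H T G_def m_def[symmetric] ab[symmetric] of_nat_add m y_def power_Suc .
    qed
    have tele: "(\<Sum>k\<le>K. H k - G k) = - G K" for K
      by (induction K) (simp_all add: H_def)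
    have "G N = 0" unfolding G_def q_def using krawt_beyond_degree[of n D] by (simp add: N_def)
    then have "(\<Sum>k\<le>N. H k - G k) = 0" using tele by simp
    have "poly ([:0, 1, 1:] * pderiv ?S) x = (\<Sum>k\<le>N. w k * (x * (1 + x) * poly (pderiv (T k)) x))"
      unfolding S pderiv_sum pderiv_smult poly_mult poly_sum poly_smult sum_distrib_left
      by (rule sum.cong) (simp_all add: algebra_simps)
    also have "\<dots> = (\<Sum>k\<le>N. (n + (N + n) * x) * (w k * poly (T k) x) + (H k - G k))"
      by (rule sum.cong) (use summand in auto)
    also have "\<dots> = (n + (N + n) * x) * (\<Sum>k\<le>N. w k * poly (T k) x)"
      by (simp add: sum.distrib sum_distrib_left \<open>(\<Sum>k\<le>N. H k - G k) = 0\<close>)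
    also have "\<dots> = poly ([:real n, real (N + n):] * ?S) x"
      unfolding S poly_mult poly_sum poly_smult by (simp add: mult.commute)
    finally show "poly ([:0, 1, 1:] * pderiv ?S) x = poly ([:real n, real (N + n):] * ?S) x" .
  qed
  have odeR: "[:0, 1, 1:] * pderiv ?R = [:real n, real (N + n):] * ?R"
  proof (rule poly_eq_poly_eq_iff[THEN iffD1], rule ext)
    fix x :: real
    define Q where "Q = monom 1 n * [:1, 1 :: real:] ^ N"
    have xm: "x * (real n * x ^ (n - 1)) = real n * x ^ n" "(1 + x) * (real N * (1 + x) ^ (N - 1)) = real N * (1 + x) ^ N"
      by (cases n, auto) (cases N, auto)
    have "x * (1 + x) * (real n * x ^ (n - 1) * (1 + x) ^ N + x ^ n * (real N * (1 + x) ^ (N - 1)))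
       = (1 + x) * (x * (real n * x ^ (n - 1))) * (1 + x) ^ N + x * x ^ n * ((1 + x) * (real N * (1 + x) ^ (N - 1)))"
      by (simp only: algebra_simps)
    also have "\<dots> = (real n + x * real (N + n)) * (x ^ n * (1 + x) ^ N)"
      unfolding xm by (simp add: algebra_simps)
    finally have e: "x * (1 + x) * (real n * x ^ (n - 1) * (1 + x) ^ N + x ^ n * (real N * (1 + x) ^ (N - 1))) = \<dots>" .
    have "poly (pderiv (monom 1 n * [:1, 1:] ^ N)) x = real n * x ^ (n - 1) * (1 + x) ^ N + x ^ n * (real N * (1 + x) ^ (N - 1))"
      unfolding pderiv_mult pderiv_power pderiv_monom by (simp add: poly_monom pderiv_pCons algebra_simps)
    with e have "x * (1 + x) * poly (pderiv Q) x = (real n + x * real (N + n)) * poly Q x"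
      unfolding Q_def by (simp only:) (simp add: poly_monom)
    moreover have "poly [:0, 1, 1:] x = x * (1 + x)" "poly [:real n, real (N + n):] x = real n + x * real (N + n)"
      by (simp_all add: algebra_simps)
    ultimately show "poly ([:0, 1, 1:] * pderiv ?R) x = poly ([:real n, real (N + n):] * ?R) x"
      unfolding Q_def[symmetric]
      by (simp only: pderiv_smult poly_mult poly_smult mult.left_commute[of _ "1 / real (N choose n)"])
  qed
  \<comment> \<open>This bound reaches N + n only at k = n.\<close>
  have T_deg: "degree (T k) \<le> N - k + (min n k + min n k)" if "k \<le> N" for k
    unfolding T_def power2_eq_square q_def
    by (intro order_trans[OF degree_mult_le] add_mono degree_krawt_le) (simp add: degree_monom_eq)
  have T_deg': "degree (T k) \<le> N + n" and T_coeff: "coeff (T k) (N + n) = (if k = n then 1 else 0)" if k: "k \<le> N" for k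
  proof -
    show "degree (T k) \<le> N + n" using T_deg[OF k] k by linarith
    show "coeff (T k) (N + n) = (if k = n then 1 else 0)"
    proof (cases "k = n")
      case True
      have "coeff (T n) ((N - n) + (n + n)) = coeff (monom 1 (N - n)) (N - n) * coeff (q n * q n) (n + n)"
        unfolding T_def power2_eq_square
        by (intro coeff_mult_top order_trans[OF degree_mult_le] add_mono)
          (use degree_krawt_le[of n D n] in \<open>auto simp: degree_monom_eq q_def\<close>)
      also have "coeff (q n * q n) (n + n) = coeff (q n) n * coeff (q n) n"
        by (rule coeff_mult_top) (use degree_krawt_le[of n D n] in \<open>auto simp: q_def\<close>)
      finally have "coeff (T n) ((N - n) + (n + n)) = 1" by (simp add: q_def coeff_krawt)
      moreover have "(N - n) + (n + n) = N + n" by (simp add: N_def)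
      ultimately show ?thesis using True by simp
    next
      case False
      then have "degree (T k) < N + n" using T_deg[OF k] k by linarith
      then show ?thesis using False by (simp add: coeff_eq_0)
    qed
  qed
  have "?S - ?R = 0"
  proof (rule binomial_ode_unique)
    show "[:0, 1, 1:] * pderiv (?S - ?R) = [:real n, real (N + n):] * (?S - ?R)"
      unfolding pderiv_diff right_diff_distrib odeS odeR ..
    have degR: "degree (monom 1 n * [:1, 1 :: real:] ^ N) \<le> n + N"
      by (intro order_trans[OF degree_mult_le] add_mono) (simp_all add: degree_monom_eq degree_power_eq)
    show "degree (?S - ?R) \<le> N + n"
      unfolding S using degR
      by (intro degree_diff_le degree_sum_le order_trans[OF degree_smult_le]) (auto intro: T_deg')
    have "coeff (monom 1 n * [:1, 1 :: real:] ^ N) (n + N) = coeff (monom 1 n) n * coeff ([:1, 1 :: real:] ^ N) N"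
      by (rule coeff_mult_top) (simp_all add: degree_monom_eq degree_power_eq)
    also have "coeff ([:1, 1 :: real:] ^ N) N = 1"
      using lead_coeff_power[of "[:1, 1 :: real:]" N] by (simp add: degree_power_eq)
    finally have "coeff ?R (N + n) = w n" by (simp add: w_def add.commute)
    moreover have "coeff ?S (N + n) = (\<Sum>k\<le>N. if k = n then w n else 0)"
      unfolding S coeff_sum by (rule sum.cong) (auto simp: T_coeff)
    then have "coeff ?S (N + n) = w n" by (simp add: N_def)
    ultimately show "coeff (?S - ?R) (N + n) = 0" by simp
  qed
  then show ?thesis by simp
qed

subsection \<open>The case \<open>a = 0\<close>\<close>

text \<open>Equal to \<open>t powr (d / 2)\<close> times the Jacobi polynomial with parameters \<open>(0, d)\<close> at \<open>2 t - 1\<close>, see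
  \<open>wigner_jacobi\<close>; meaningful only for \<open>0 < t < 1\<close>.\<close>

definition wigner :: "nat \<Rightarrow> real \<Rightarrow> real \<Rightarrow> real" where
  "wigner n d t = t powr (d / 2) * ((1 - t) ^ n * poly (krawt n d n) (t / (1 - t)))"

text \<open>Substitute r = t / (1 - t) in \<open>krawt_square\<close> and multiply by t^d (1 - t)^(2
  n); as (1 - t) (1 + r) = 1, the padding in \<open>wigner_poly\<close> disappears.\<close>

lemma wigner_square:
  assumes "d \<ge> 0" and t: "0 < t" "t < 1"
  shows "\<exists>C. (\<forall>k\<le>2 * n. C k \<ge> 0) \<and> (\<Sum>k\<le>2 * n. C k) = 1
    \<and> (wigner n d t)\<^sup>2 = (\<Sum>k\<le>2 * n. C k * wigner k (2 * d) t)"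
proof -
  obtain C where C: "\<forall>k\<le>2 * n. C k \<ge> 0" "(\<Sum>k\<le>2 * n. C k) = 1"
    "(krawt n d n)\<^sup>2 = (\<Sum>k\<le>2 * n. smult (C k) (wigner_poly (2 * n) (2 * d) k))"
    using krawt_square[OF assms(1), of n] by blast
  define r where "r = t / (1 - t)"
  have "(wigner n d t)\<^sup>2 = (t powr (d / 2))\<^sup>2 * ((1 - t) ^ (2 * n) * poly ((krawt n d n)\<^sup>2) r)"
    by (simp add: wigner_def r_def power_mult_distrib power_mult[symmetric] mult.commute)
  also have "(t powr (d / 2))\<^sup>2 = t powr d"
    by (simp add: power2_eq_square flip: powr_add)
  also have "t powr d * ((1 - t) ^ (2 * n) * poly ((krawt n d n)\<^sup>2) r) = (\<Sum>k\<le>2 * n. C k * wigner k (2 * d) t)"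
    unfolding C(3) poly_sum sum_distrib_left
  proof (rule sum.cong[OF refl])
    fix k assume k: "k \<in> {..2 * n}"
    have "1 + r = 1 / (1 - t)" using t by (simp add: r_def field_simps)
    then have "(1 - t) ^ (2 * n - k) * (1 + r) ^ (2 * n - k) = 1"
      using t by (simp flip: power_mult_distrib)
    moreover have "(1 - t) ^ (2 * n) = (1 - t) ^ (2 * n - k) * (1 - t) ^ k"
      using k by (simp flip: power_add)
    then have "(1 - t) ^ (2 * n) * (1 + r) ^ (2 * n - k) = ((1 - t) ^ (2 * n - k) * (1 + r) ^ (2 * n - k)) * (1 - t) ^ k"
      by (simp only: mult_ac)
    ultimately have "(1 - t) ^ (2 * n) * (1 + r) ^ (2 * n - k) = (1 - t) ^ k"
      by simp
    then have "t powr d * (C k * ((1 - t) ^ (2 * n) * (1 + r) ^ (2 * n - k)) * poly (krawt k (2 * d) k) r)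
        = C k * (t powr d * ((1 - t) ^ k * poly (krawt k (2 * d) k) r))"
      by simp
    then show "t powr d * ((1 - t) ^ (2 * n) * poly (smult (C k) (wigner_poly (2 * n) (2 * d) k)) r) = C k * wigner k (2 * d) t"
      by (simp add: wigner_def wigner_poly_def r_def mult_ac)
  qed
  finally show ?thesis using C(1,2) by blast
qed

text \<open>Of the nonnegative terms summed by \<open>krawt_sum_squares\<close>, keep only k = n;
  its weight cancels against the right-hand side.\<close>

lemma abs_wigner_le_1_nat:
  assumes t: "0 < t" "t < 1"
  shows "\<bar>wigner n (real D) t\<bar> \<le> 1"
proof -
  define N where "N = 2 * n + D"
  define r where "r = t / (1 - t)"
  define q where "q k = poly (krawt n (real D) k) r" for k
  have r: "r > 0" "1 + r = 1 / (1 - t)" using t by (auto simp: r_def field_simps)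
  have w: "1 / real (N choose n) > 0" by (simp add: N_def)
  have "(1 / real (N choose n)) * (r ^ (N - n) * (q n)\<^sup>2) \<le> (\<Sum>k\<le>N. (1 / real (N choose k)) * (r ^ (N - k) * (q k)\<^sup>2))"
    using r by (intro member_le_sum) (auto simp: N_def)
  also have "\<dots> = (1 / real (N choose n)) * (r ^ n * (1 + r) ^ N)"
    using arg_cong[OF krawt_sum_squares[of n D], of "\<lambda>p. poly p r"]
    by (simp add: poly_sum poly_monom q_def N_def)
  finally have "r ^ (N - n) * (q n)\<^sup>2 \<le> r ^ n * (1 + r) ^ N"
    using w by (simp only: mult_le_cancel_left_pos)
  also have "N - n = n + D" by (simp add: N_def)
  finally have "r ^ D * (q n)\<^sup>2 \<le> (1 + r) ^ N"
    using r by (simp add: power_add mult.assoc)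
  then have "(1 - t) ^ N * (r ^ D * (q n)\<^sup>2) \<le> (1 - t) ^ N * (1 + r) ^ N"
    using t by (intro mult_left_mono) auto
  also have "\<dots> = 1" using r t by (simp flip: power_mult_distrib)
  also have "(1 - t) ^ N = (1 - t) ^ D * (1 - t) ^ (2 * n)" by (simp add: N_def power_add)
  also have "(1 - t) ^ D * (1 - t) ^ (2 * n) * (r ^ D * (q n)\<^sup>2) = ((1 - t) * r) ^ D * ((1 - t) ^ (2 * n) * (q n)\<^sup>2)"
    by (simp add: power_mult_distrib)
  also have "(1 - t) * r = t" using t by (simp add: r_def)
  finally have "t ^ D * ((1 - t) ^ (2 * n) * (q n)\<^sup>2) \<le> 1" .
  moreover have "(wigner n D t)\<^sup>2 = t ^ D * ((1 - t) ^ (2 * n) * (q n)\<^sup>2)"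
  proof -
    have "(t powr (D / 2))\<^sup>2 = t ^ D"
      using t by (simp add: power2_eq_square powr_realpow flip: powr_add)
    then show ?thesis
      by (simp add: wigner_def q_def r_def power_mult_distrib power_mult[symmetric] mult.commute)
  qed
  ultimately have "(wigner n D t)\<^sup>2 \<le> 1" by simp
  then show ?thesis by (simp only: abs_square_le_1)
qed

text \<open>Squaring doubles d and so lowers the power of 2 in the denominator. The induction treats
  all n at once because the convex combination involves degrees up to 2 n.\<close>

lemma abs_wigner_le_1_dyadic:
  assumes t: "0 < t" "t < 1"
  shows "\<bar>wigner n (real m / 2 ^ i) t\<bar> \<le> 1"
proof (induction i arbitrary: n)
  case 0
  then show ?case using abs_wigner_le_1_nat[OF t] by simp
next
  case (Suc i)
  define d where "d = real m / 2 ^ Suc i"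
  have d: "d \<ge> 0" "2 * d = real m / 2 ^ i" by (auto simp: d_def)
  obtain C where C: "\<forall>k\<le>2 * n. C k \<ge> 0" "(\<Sum>k\<le>2 * n. C k) = 1"
    "(wigner n d t)\<^sup>2 = (\<Sum>k\<le>2 * n. C k * wigner k (2 * d) t)"
    using wigner_square[OF d(1) t, of n] by blast
  have "(wigner n d t)\<^sup>2 \<le> (\<Sum>k\<le>2 * n. C k * 1)"
    unfolding C(3) using C(1) Suc.IH unfolding d(2)
    by (intro sum_mono mult_left_mono) (auto simp: abs_le_iff)
  then have "(wigner n d t)\<^sup>2 \<le> 1" using C(2) by simp
  then show ?case unfolding d_def by (simp only: abs_square_le_1)
qed

lemma abs_wigner_le_1:
  assumes t: "0 < t" "t < 1" and d: "d \<ge> 0"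
  shows "\<bar>wigner n d t\<bar> \<le> 1"
proof -
  define e where "e i = real (nat \<lfloor>d * 2 ^ i\<rfloor>) / 2 ^ i" for i :: nat
  have e: "\<bar>e i - d\<bar> \<le> (1 / 2) ^ i" for i
  proof -
    have "real (nat \<lfloor>d * 2 ^ i\<rfloor>) = of_int \<lfloor>d * 2 ^ i\<rfloor>" using d by simp
    then have "\<bar>real (nat \<lfloor>d * 2 ^ i\<rfloor>) - d * 2 ^ i\<bar> \<le> 1" by linarith
    moreover have "e i - d = (real (nat \<lfloor>d * 2 ^ i\<rfloor>) - d * 2 ^ i) / 2 ^ i"
      by (simp add: e_def field_simps)
    ultimately show ?thesis by (simp add: power_one_over divide_right_mono)
  qed
  have "e \<longlonglongrightarrow> d"
  proof (rule LIM_zero_cancel, rule Lim_null_comparison)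
    show "\<forall>\<^sub>F i in sequentially. norm (e i - d) \<le> (1 / 2) ^ i" using e by simp
    show "(\<lambda>i. (1 / 2 :: real) ^ i) \<longlonglongrightarrow> 0" by (rule LIMSEQ_realpow_zero) auto
  qed
  \<comment> \<open>For fixed t > 0, d enters only through an exponent of t and through binomials
    polynomial in d.\<close>
  moreover have "isCont (\<lambda>d. wigner n d t) d"
  proof -
    have "isCont (\<lambda>d. (real n + d) gchoose m) d" for m
      unfolding gbinomial_prod_rev by (intro continuous_intros) auto
    then have c1: "isCont (\<lambda>d. if j \<le> n then real (n choose j) * ((real n + d) gchoose (n - j)) * (-1) ^ (n - j) else 0) d" for j
      by (cases "j \<le> n") (auto intro!: isCont_mult)
    have c2: "isCont (\<lambda>d. t powr (d / 2)) d"
      using t by (intro continuous_intros) auto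
    show ?thesis
      unfolding wigner_def krawt_def poly_sum poly_monom
      by (intro isCont_mult isCont_sum continuous_const ballI c1 c2)
  qed
  ultimately have "(\<lambda>i. wigner n (e i) t) \<longlonglongrightarrow> wigner n d t"
    by (rule isCont_tendsto_compose[rotated])
  then have "(\<lambda>i. \<bar>wigner n (e i) t\<bar>) \<longlonglongrightarrow> \<bar>wigner n d t\<bar>" by (rule tendsto_rabs)
  then show ?thesis
    by (rule LIMSEQ_le_const2) (use abs_wigner_le_1_dyadic[OF t] in \<open>auto simp: e_def\<close>)
qed

text \<open>The factor (1 - t)^n turns r^j into (1 - t)^(n - j) t^j; then s = n - j gives the terms
  of \<open>jacobi_P\<close> with a = 0.\<close>

lemma wigner_jacobi:
  assumes t: "0 < t" "t < 1"
  shows "wigner n d t = t powr (d / 2) * jacobi_P n 0 d (2 * t - 1)"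
proof -
  define r where "r = t / (1 - t)"
  have "(1 - t) ^ n * poly (krawt n d n) r =
    (\<Sum>j\<le>n. real (n choose j) * ((real n + d) gchoose (n - j)) * (-1) ^ (n - j) * (1 - t) ^ (n - j) * t ^ j)"
    unfolding krawt_def poly_sum sum_distrib_left
  proof (rule sum.cong[OF refl])
    fix j assume j: "j \<in> {..n}"
    then have "(1 - t) ^ n = (1 - t) ^ (n - j) * (1 - t) ^ j"
      by (simp flip: power_add)
    then have "(1 - t) ^ n * r ^ j = (1 - t) ^ (n - j) * ((1 - t) * r) ^ j"
      by (simp add: power_mult_distrib)
    also have "(1 - t) * r = t" using t by (simp add: r_def)
    finally show "(1 - t) ^ n * poly (monom (if j \<le> n then real (n choose j) * ((real n + d) gchoose (n - j)) * (-1) ^ (n - j) else 0) j) r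
      = real (n choose j) * ((real n + d) gchoose (n - j)) * (-1) ^ (n - j) * (1 - t) ^ (n - j) * t ^ j"
      using j by (simp add: poly_monom)
  qed
  also have "\<dots> = (\<Sum>s\<le>n. real (n choose (n - s)) * ((real n + d) gchoose s) * (-1) ^ s * (1 - t) ^ s * t ^ (n - s))"
    by (rule sum.reindex_bij_witness[of _ "\<lambda>s. n - s" "\<lambda>s. n - s"]) auto
  also have "\<dots> = jacobi_P n 0 d (2 * t - 1)"
    unfolding jacobi_P_def
  proof (rule sum.cong[OF refl])
    fix s
    have "(2 * t - 1 - 1) / 2 = - 1 * (1 - t)" "(2 * t - 1 + 1) / 2 = t" by auto
    then show "real (n choose (n - s)) * ((real n + d) gchoose s) * (-1) ^ s * (1 - t) ^ s * t ^ (n - s) =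
      ((real n + 0) gchoose (n - s)) * ((real n + d) gchoose s) * ((2 * t - 1 - 1) / 2) ^ s * ((2 * t - 1 + 1) / 2) ^ (n - s)"
      by (simp only: power_mult_distrib binomial_gbinomial add_0_right mult.assoc)
  qed
  finally show ?thesis by (simp add: wigner_def r_def)
qed

subsection \<open>The case \<open>a < 0\<close>\<close>

text \<open>Expand (t - 1)^s and sum over s by trinomial revision and Vandermonde. Beta averages act
  termwise on powers of t.\<close>

lemma jacobi_P_expansion:
  "jacobi_P n a b (2 * t - 1) =
    (\<Sum>k\<le>n. (-1) ^ (n - k) * ((real n + a + b + real k) gchoose k) * ((real n + b) gchoose (n - k)) * t ^ k)"
proof -
  let ?A = "real n + a" and ?B = "real n + b"
  have "jacobi_P n a b (2 * t - 1) =
    (\<Sum>s\<le>n. \<Sum>i\<le>n. (-1) ^ i * t ^ (n - i) * ((?A gchoose (n - s)) * ((?B gchoose s) * (real s gchoose i))))"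
    unfolding jacobi_P_def
  proof (rule sum.cong[OF refl])
    fix s assume s: "s \<in> {..n}"
    have e: "(2 * t - 1 - 1) / 2 = - 1 + t" "(2 * t - 1 + 1) / 2 = t" by auto
    have "(- 1 + t) ^ s * t ^ (n - s) = (\<Sum>i\<le>s. real (s choose i) * (-1) ^ i * t ^ (s - i) * t ^ (n - s))"
      by (simp only: binomial_ring sum_distrib_right)
    also have "\<dots> = (\<Sum>i\<le>s. (-1) ^ i * t ^ (n - i) * (real s gchoose i))"
      by (rule sum.cong) (use s in \<open>auto simp: binomial_gbinomial mult_ac simp flip: power_add\<close>)
    also have "\<dots> = (\<Sum>i\<le>n. (-1) ^ i * t ^ (n - i) * (real s gchoose i))"
      by (rule sum.mono_neutral_left) (use s in \<open>auto simp: binomial_eq_0 simp flip: binomial_gbinomial\<close>)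
    finally have F: "(- 1 + t) ^ s * t ^ (n - s) = (\<Sum>i\<le>n. (-1) ^ i * t ^ (n - i) * (real s gchoose i))" .
    show "(?A gchoose (n - s)) * (?B gchoose s) * ((2 * t - 1 - 1) / 2) ^ s * ((2 * t - 1 + 1) / 2) ^ (n - s) =
      (\<Sum>i\<le>n. (-1) ^ i * t ^ (n - i) * ((?A gchoose (n - s)) * ((?B gchoose s) * (real s gchoose i))))"
      unfolding e mult.assoc F sum_distrib_left by (intro sum.cong refl) (simp only: mult_ac)
  qed
  also have "\<dots> = (\<Sum>i\<le>n. (-1) ^ i * t ^ (n - i) * (\<Sum>s\<le>n. (?A gchoose (n - s)) * ((?B gchoose s) * (real s gchoose i))))"
    by (subst sum.swap) (simp add: sum_distrib_left)
  also have "\<dots> = (\<Sum>i\<le>n. (-1) ^ i * t ^ (n - i) * ((?B gchoose i) * ((real n + a + b + real (n - i)) gchoose (n - i))))"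
  proof (rule sum.cong[OF refl])
    fix i assume i: "i \<in> {..n}"
    have "(\<Sum>s\<le>n. (?A gchoose (n - s)) * ((?B gchoose s) * (real s gchoose i))) =
      (\<Sum>s\<in>{i..n}. (?A gchoose (n - s)) * ((?B gchoose s) * (real s gchoose i)))"
      by (rule sum.mono_neutral_right) (auto simp: binomial_eq_0 simp flip: binomial_gbinomial)
    also have "\<dots> = (\<Sum>l\<in>{0..n - i}. (?B gchoose i) * (((?B - real i) gchoose l) * (?A gchoose (n - i - l))))"
    proof (rule sum.reindex_bij_witness[of _ "\<lambda>l. l + i" "\<lambda>s. s - i"])
      fix s assume "s \<in> {i..n}"
      then show "(?B gchoose i) * (((?B - real i) gchoose (s - i)) * (?A gchoose (n - i - (s - i)))) =
         (?A gchoose (n - s)) * ((?B gchoose s) * (real s gchoose i))"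
        using gbinomial_trinomial_revision[of i s ?B] by simp
    qed (use i in auto)
    also have "\<dots> = (?B gchoose i) * ((?B - real i + ?A) gchoose (n - i))"
      by (simp only: gbinomial_Vandermonde flip: sum_distrib_left)
    also have "?B - real i + ?A = real n + a + b + real (n - i)" using i by (simp add: of_nat_diff)
    finally show "(-1) ^ i * t ^ (n - i) * (\<Sum>s\<le>n. (?A gchoose (n - s)) * ((?B gchoose s) * (real s gchoose i))) =
      (-1) ^ i * t ^ (n - i) * ((?B gchoose i) * ((real n + a + b + real (n - i)) gchoose (n - i)))" by simp
  qed
  also have "\<dots> = (\<Sum>k\<le>n. (-1) ^ (n - k) * ((real n + a + b + real k) gchoose k) * (?B gchoose (n - k)) * t ^ k)"
    by (rule sum.reindex_bij_witness[of _ "\<lambda>k. n - k" "\<lambda>k. n - k"]) (auto simp: mult_ac)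
  finally show ?thesis .
qed

section \<open>Moments and log-convexity of the beta function\<close>

lemma Beta_real_pos: "x > 0 \<Longrightarrow> y > 0 \<Longrightarrow> Beta x y > 0" for x y :: real
  by (simp add: Beta_def)

text \<open>Iterates the recurrence of \<open>Beta\<close> in its first argument; this encodes the
  k-th moment of the beta distribution without division.\<close>

lemma Beta_add_nat:
  fixes x y :: real
  assumes "x > 0" "y > 0"
  shows "pochhammer (x + y) k * Beta (x + real k) y = pochhammer x k * Beta x y"
proof (induction k)
  case (Suc k)
  have "(x + real k + y) * Beta (x + real k + 1) y = (x + real k) * Beta (x + real k) y"
    by (rule Beta_plus1_left) (use assms in \<open>auto elim!: nonpos_Ints_cases\<close>)
  then have "pochhammer (x + y) (Suc k) * Beta (x + real (Suc k)) y =
      pochhammer (x + y) k * ((x + real k) * Beta (x + real k) y)"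
    by (simp add: pochhammer_Suc mult.assoc add_ac)
  also have "\<dots> = pochhammer x (Suc k) * Beta x y"
    using Suc by (simp add: pochhammer_Suc mult_ac)
  finally show ?case .
qed simp

text \<open>The Cauchy-Schwarz inequality for the beta integral, derived from a pointwise
  arithmetic-geometric mean inequality with parameter \<open>c\<close>.\<close>

lemma Beta_midpoint_log_convex:
  fixes x y z :: real
  assumes "x > 0" "y > 0" "z > 0"
  shows "(Beta ((x + y) / 2) z)\<^sup>2 \<le> Beta x z * Beta y z"
proof -
  have pos: "Beta x z > 0" "Beta y z > 0" "Beta ((x + y) / 2) z > 0" using assms by (auto intro!: Beta_real_pos)
  \<comment> \<open>The value that minimises \<open>c * Beta x z + Beta y z / c\<close>; it makes
    both summands equal.\<close>
  define c where "c = sqrt (Beta y z / Beta x z)"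
  have c: "c > 0" "c\<^sup>2 = Beta y z / Beta x z" using pos by (simp_all add: c_def)
  let ?f = "\<lambda>x s. s powr (x - 1) * (1 - s) powr (z - 1)"
  have "2 * Beta ((x + y) / 2) z \<le> c * Beta x z + Beta y z / c"
  proof (rule has_integral_le)
    show "((\<lambda>s. 2 * ?f ((x + y) / 2) s) has_integral 2 * Beta ((x + y) / 2) z) {0..1}"
      using assms by (intro has_integral_mult_right has_integral_Beta_real) auto
    show "((\<lambda>s. c * ?f x s + ?f y s / c) has_integral c * Beta x z + Beta y z / c) {0..1}"
      using assms by (intro has_integral_add has_integral_mult_right has_integral_divide has_integral_Beta_real) auto
    fix s :: real assume s: "s \<in> {0..1}"
    define g h where "g = s powr ((x - 1) / 2)" "h = s powr ((y - 1) / 2)"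
    have gh: "s powr (x - 1) = g\<^sup>2" "s powr (y - 1) = h\<^sup>2" "s powr ((x + y) / 2 - 1) = g * h"
      unfolding g_h_def power2_eq_square powr_add[symmetric]
      by (intro arg_cong[where f = "(powr) s"], simp add: field_simps)+
    have "0 \<le> (c * g - h)\<^sup>2 / c" using c by simp
    also have "\<dots> = c * g\<^sup>2 + h\<^sup>2 / c - 2 * (g * h)"
      using c by (simp add: power2_eq_square field_simps)
    finally have "(2 * (g * h)) * (1 - s) powr (z - 1) \<le> (c * g\<^sup>2 + h\<^sup>2 / c) * (1 - s) powr (z - 1)"
      by (intro mult_right_mono) auto
    then show "2 * ?f ((x + y) / 2) s \<le> c * ?f x s + ?f y s / c"
      unfolding gh by (simp add: algebra_simps)
  qed
  also have "Beta y z = c\<^sup>2 * Beta x z" using c pos by simp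
  also have "c * Beta x z + c\<^sup>2 * Beta x z / c = 2 * (c * Beta x z)"
    using c(1) by (simp add: power2_eq_square)
  finally have "(Beta ((x + y) / 2) z)\<^sup>2 \<le> (c * Beta x z)\<^sup>2"
    using pos by (intro power_mono) auto
  also have "\<dots> = Beta x z * Beta y z"
    unfolding power_mult_distrib c(2) using pos by (simp add: power2_eq_square)
  finally show ?thesis .
qed

text \<open>In the expansion in powers of t, a enters only through (n + a + d + k choose k), the
  rising factorial of p over k!. The k-th moment of s exchanges the rising factorial of p - a for
  that of p.\<close>

lemma jacobi_P_Beta_average:
  fixes a d t :: real and n :: nat
  assumes "-1 < a" "a < 0" "d \<ge> 0"
  defines "p \<equiv> real n + a + d + 1"
  shows "((\<lambda>s. s powr (p - 1) * (1 - s) powr (- a - 1) * jacobi_P n 0 d (2 * (t * s) - 1))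
    has_integral (Beta p (- a) * jacobi_P n a d (2 * t - 1))) {0..1}"
proof -
  have p: "p > 0" using assms by simp
  define c where "c k = (-1) ^ (n - k) * ((real n + d + real k) gchoose k) * ((real n + d) gchoose (n - k)) * t ^ k" for k
  have "((\<lambda>s. \<Sum>k\<le>n. c k * (s powr (p + real k - 1) * (1 - s) powr (- a - 1))) has_integral (\<Sum>k\<le>n. c k * Beta (p + real k) (- a))) {0..1}"
    using p assms by (intro has_integral_sum has_integral_mult_right has_integral_Beta_real) auto
  also have "(\<Sum>k\<le>n. c k * Beta (p + real k) (- a)) = Beta p (- a) * jacobi_P n a d (2 * t - 1)"
    unfolding jacobi_P_expansion sum_distrib_left
  proof (rule sum.cong[OF refl])
    fix k
    have 1: "((real n + d + real k) gchoose k) = pochhammer (p + - a) k / fact k"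
      unfolding gbinomial_pochhammer' by (simp add: p_def algebra_simps)
    have 2: "((real n + a + d + real k) gchoose k) = pochhammer p k / fact k"
      unfolding gbinomial_pochhammer' by (simp add: p_def algebra_simps)
    have "((real n + d + real k) gchoose k) * Beta (p + real k) (- a) = ((real n + a + d + real k) gchoose k) * Beta p (- a)"
      unfolding 1 2 using Beta_add_nat[of p "- a" k] p assms by simp
    then show "c k * Beta (p + real k) (- a) = Beta p (- a) * ((-1) ^ (n - k) * ((real n + a + d + real k) gchoose k)
        * ((real n + d) gchoose (n - k)) * t ^ k)"
      unfolding c_def by (simp add: mult_ac)
  qed
  finally show ?thesis
  proof (rule has_integral_eq[rotated])
    fix s :: real assume "s \<in> {0..1}"
    have "c k * (s powr (p + real k - 1) * (1 - s) powr (- a - 1)) =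
        s powr (p - 1) * (1 - s) powr (- a - 1) * (c k * s ^ k)" for k
    \<comment> \<open>At s = 0 both sides are 0, since \<open>0 powr y = 0\<close> for every
      exponent.\<close>
    proof (cases "s = 0")
      case False
      then have "s powr (p + real k - 1) = s powr (p - 1) * s ^ k"
        using \<open>s \<in> _\<close> by (simp add: powr_add powr_diff powr_realpow)
      then show ?thesis by simp
    qed simp
    then have "(\<Sum>k\<le>n. c k * (s powr (p + real k - 1) * (1 - s) powr (- a - 1))) =
        s powr (p - 1) * (1 - s) powr (- a - 1) * (\<Sum>k\<le>n. c k * s ^ k)"
      by (simp only: sum_distrib_left)
    also have "(\<Sum>k\<le>n. c k * s ^ k) = jacobi_P n 0 d (2 * (t * s) - 1)"
      unfolding jacobi_P_expansion[of n 0] c_def by (simp add: power_mult_distrib mult.assoc)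
    finally show "(\<Sum>k\<le>n. c k * (s powr (p + real k - 1) * (1 - s) powr (- a - 1))) =
        s powr (p - 1) * (1 - s) powr (- a - 1) * jacobi_P n 0 d (2 * (t * s) - 1)" .
  qed
qed

text \<open>The bound for a = 0 at t s is (t s)^(- d / 2): the weight on the left absorbs the power
  of t, and the power of s lowers the first beta parameter by d / 2.\<close>

lemma abs_jacobi_P_le_Beta:
  fixes a d t :: real and n :: nat
  assumes a: "-1 < a" "a < 0" and d: "d \<ge> 0" and t: "0 < t" "t \<le> 1"
  defines "p \<equiv> real n + a + d + 1"
  shows "Beta p (- a) * (t powr (d / 2) * \<bar>jacobi_P n a d (2 * t - 1)\<bar>) \<le> Beta (p - d / 2) (- a)"
proof -
  define g where "g s = t powr (d / 2) * (s powr (p - 1) * (1 - s) powr (- a - 1) * jacobi_P n 0 d (2 * (t * s) - 1))" for s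
  define G where "G = t powr (d / 2) * (Beta p (- a) * jacobi_P n a d (2 * t - 1))"
  have p: "p > 0" "p - d / 2 > 0" using a d by (simp_all add: p_def field_simps)
  have int_g: "(g has_integral G) {0..1}"
    unfolding g_def G_def p_def using jacobi_P_Beta_average[OF a d]
    by (intro has_integral_mult_right)
  have int_B: "((\<lambda>s. s powr (p - d / 2 - 1) * (1 - s) powr (- a - 1)) has_integral Beta (p - d / 2) (- a)) {0..1}"
    using p a by (intro has_integral_Beta_real) auto
  have bound: "\<bar>g s\<bar> \<le> s powr (p - d / 2 - 1) * (1 - s) powr (- a - 1)" if "s \<in> {0..1}" for s
  \<comment> \<open>At the endpoints a \<open>powr\<close> with base 0 makes both sides 0; elsewhere
    0 < t s < 1, even for t = 1.\<close>
  proof (cases "s = 0 \<or> s = 1")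
    case False
    with that have s: "0 < s" "s < 1" by auto
    have ts: "0 < t * s" "t * s < 1" using s t mult_le_less_imp_less[of t 1 s 1] by auto
    have "(t * s) powr (d / 2) * \<bar>jacobi_P n 0 d (2 * (t * s) - 1)\<bar> \<le> 1"
      using abs_wigner_le_1[OF ts d, of n] wigner_jacobi[OF ts, of n d] by (simp add: abs_mult)
    then have "(s powr (p - d / 2 - 1) * (1 - s) powr (- a - 1)) * ((t * s) powr (d / 2) * \<bar>jacobi_P n 0 d (2 * (t * s) - 1)\<bar>)
        \<le> (s powr (p - d / 2 - 1) * (1 - s) powr (- a - 1)) * 1"
      by (intro mult_left_mono) auto
    moreover have "s powr (p - 1) = s powr (p - d / 2 - 1) * s powr (d / 2)" by (simp flip: powr_add)
    ultimately show ?thesis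
      using s t by (simp add: g_def abs_mult powr_mult mult_ac)
  qed (auto simp: g_def)
  have "\<bar>G\<bar> \<le> Beta (p - d / 2) (- a)"
    unfolding abs_le_iff
  proof
    show "G \<le> Beta (p - d / 2) (- a)"
      by (rule has_integral_le[OF int_g int_B]) (use bound in \<open>auto simp: abs_le_iff\<close>)
    show "- G \<le> Beta (p - d / 2) (- a)"
      by (rule has_integral_le[OF has_integral_neg[OF int_g] int_B]) (use bound in \<open>auto simp: abs_le_iff\<close>)
  qed
  moreover have "Beta p (- a) > 0" using p a by (intro Beta_real_pos) auto
  ultimately show ?thesis by (simp add: G_def abs_mult mult_ac)
qed

text \<open>The normalising factor is the root of \<open>Beta p (- a) / Beta q (- a)\<close>, and p
  - d / 2 is the midpoint of p and q, so midpoint log-convexity matches the integral bound.\<close>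

lemma abs_jacobi_B_le_1_neg:
  assumes a: "-1 < a" "a < 0" and d: "d \<ge> 0" and x: "-1 < x" "x \<le> 1"
  shows "\<bar>jacobi_B n d a x\<bar> \<le> 1"
proof -
  define t where "t = (1 + x) / 2"
  have t: "0 < t" "t \<le> 1" "x = 2 * t - 1" using x by (auto simp: t_def field_simps)
  define p where "p = real n + a + d + 1"
  define q where "q = real n + a + 1"
  have pq: "p > 0" "q > 0" "p - d / 2 = (q + p) / 2" using a d by (auto simp: p_def q_def field_simps)
  have pos: "Beta p (- a) > 0" "Beta q (- a) > 0" using pq a by (auto intro: Beta_real_pos)
  define P where "P = t powr (d / 2) * \<bar>jacobi_P n a d x\<bar>"
  have "Gamma (- a) \<noteq> 0" using a by (auto simp: Gamma_eq_zero_iff elim!: nonpos_Ints_cases)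
  then have norm: "Gamma (real n + 1) * Gamma (real n + a + d + 1) / (Gamma (real n + a + 1) * Gamma (real n + d + 1))
     = Beta p (- a) / Beta q (- a)"
  proof -
    have eq: "real n + 1 = q + - a" "real n + d + 1 = p + - a" "real n + a + d + 1 = p" "real n + a + 1 = q"
      by (simp_all add: p_def q_def)
    show ?thesis unfolding eq Beta_def using \<open>Gamma (- a) \<noteq> 0\<close> by (simp add: mult.commute)
  qed
  have w: "(if d = 0 then 1 else ((1 + x) / 2) powr (d / 2)) = t powr (d / 2)"
    using t(1) by (simp add: t_def)
  have B: "\<bar>jacobi_B n d a x\<bar> = sqrt (Beta p (- a) / Beta q (- a)) * P"
    unfolding jacobi_B_def norm w P_def using pos by (simp add: abs_mult)
  have "Beta p (- a) * P \<le> Beta ((q + p) / 2) (- a)"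
    using abs_jacobi_P_le_Beta[OF a d t(1,2), of n] unfolding P_def t(3) p_def[symmetric] pq(3) .
  then have "(Beta p (- a) * P)\<^sup>2 \<le> (Beta ((q + p) / 2) (- a))\<^sup>2"
    using pos by (intro power_mono) (auto simp: P_def)
  also have "\<dots> \<le> Beta q (- a) * Beta p (- a)"
    using pq a by (intro Beta_midpoint_log_convex) auto
  finally have "Beta p (- a) * P\<^sup>2 \<le> Beta q (- a)"
    using pos by (simp add: power_mult_distrib power2_eq_square mult_ac)
  then have "\<bar>jacobi_B n d a x\<bar>\<^sup>2 \<le> 1"
    unfolding B power_mult_distrib using pos by (simp add: divide_simps)
  then show ?thesis by (simp only: abs_square_le_1 abs_abs)
qed

lemma abs_jacobi_B_le_1_zero:
  assumes d: "d \<ge> 0" and x: "-1 < x" "x \<le> 1"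
  shows "\<bar>jacobi_B n d 0 x\<bar> \<le> 1"
proof -
  have "Gamma (real n + 1) \<noteq> 0" "Gamma (real n + d + 1) \<noteq> 0"
    using d by (simp_all add: Gamma_real_pos less_imp_neq[symmetric])
  then have B: "jacobi_B n d 0 x = (if d = 0 then 1 else ((1 + x) / 2) powr (d / 2)) * jacobi_P n 0 d x"
    unfolding jacobi_B_def by simp
  show ?thesis
  \<comment> \<open>The link to \<open>wigner\<close> requires t < 1; at x = 1 the Jacobi polynomial
    with a = 0 equals 1.\<close>
  proof (cases "x = 1")
    case True
    then show ?thesis unfolding B using jacobi_P_at_1[of 0 n d] by (simp add: Gamma_fact add.commute)
  next
    case False
    then have t: "0 < (1 + x) / 2" "(1 + x) / 2 < 1" using x by auto
    then have "jacobi_B n d 0 x = wigner n d ((1 + x) / 2)"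
      unfolding B wigner_jacobi[OF t] by (simp add: add_divide_distrib)
    then show ?thesis using abs_wigner_le_1[OF t d] by simp
  qed
qed

text \<open>At x = -1 only the summand s = n survives, with value (-1)^n, and for d = 0 the
  normalising factor and the weight are 1.\<close>

lemma abs_jacobi_B_minus_1:
  assumes "-1 < a"
  shows "\<bar>jacobi_B n 0 a (-1)\<bar> = 1"
proof -
  have "jacobi_P n a 0 (-1) = (\<Sum>s\<le>n. if s = n then (-1) ^ n else 0)"
    unfolding jacobi_P_def by (rule sum.cong) (auto simp flip: binomial_gbinomial)
  then have "\<bar>jacobi_P n a 0 (-1)\<bar> = 1" by simp
  moreover have "Gamma (real n + 1) \<noteq> 0" "Gamma (real n + a + 1) \<noteq> 0"
    using assms by (simp_all add: Gamma_real_pos less_imp_neq[symmetric])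
  ultimately show ?thesis unfolding jacobi_B_def by (simp add: abs_mult)
qed

theorem theorem8p1:
  fixes a :: real
  assumes "-1 < a" and "a \<le> 0"
  shows "(\<forall>d\<ge>0. \<forall>n. \<forall>x\<in>{-1..1}. \<bar>jacobi_B n d a x\<bar> \<le> 1)
       \<and> (\<forall>n. \<bar>jacobi_B n 0 a (-1)\<bar> = 1)"
proof (intro conjI allI impI ballI)
  fix d :: real and n x
  assume d: "0 \<le> d" and "x \<in> {-1..1 :: real}"
  then consider "x = -1" "d = 0" | "x = -1" "d > 0" | "-1 < x" "x \<le> 1" by fastforce
  then show "\<bar>jacobi_B n d a x\<bar> \<le> 1"
  proof cases
    case 1
    then show ?thesis using abs_jacobi_B_minus_1[OF assms(1)] by simp
  next
    case 2
    \<comment> \<open>Here the weight is \<open>0 powr (d / 2) = 0\<close>.\<close>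
    then show ?thesis by (simp add: jacobi_B_def)
  next
    case 3
    then show ?thesis
      using abs_jacobi_B_le_1_zero[OF d] abs_jacobi_B_le_1_neg[OF assms(1) _ d] assms(2)
      by (cases "a = 0") auto
  qed
qed (rule abs_jacobi_B_minus_1[OF assms(1)])

end
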